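(* Let $p_1<p_2<\ldots$ be the sequence of all primes, let $$E=\left\{\prod_{1\le i\le k,\ i\ne j}p_i:\ k=2,3,\ldots,\ 1\le j\le k\right\},$$ and let the sequence $n_1<n_2<\ldots$ consist of all the integers of $E$. If the increasing function $\phi:\mathbb{R}^+\to\mathbb{R}^+$ satisfies $$\lim_{x\to\infty}\frac{\phi(x)\ln\ln x}{x\ln x}=0,$$ then there exists a function $f\in L^\phi(\mathbb{T})$ such that the sequence $R_{n_k}f(x)$ is divergent for every $x\in\mathbb{T}$.
   Context: $\mathbb{T}=\mathbb{R}/\mathbb{Z}=[0,1)$ is the torus with Lebesgue measure. For a function $f$ on $\mathbb{T}$ and a positive integer $n$, $R_nf(x)=\frac1n\sum_{k=0}^{n-1}f\left(x+\frac kn\right)$. $L^\phi(\mathbb{T})$ denotes the class of (measurable) functions $f$ on $\mathbb{T}$ with $\phi(|f|)\in L^1(\mathbb{T})$. Divergent means not convergent to a finite limit. *)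

theory Defs
  imports
    "HOL-Analysis.Analysis"
    "HOL-Computational_Algebra.Primes"
    "HOL-Library.Infinite_Set"
    "HOL-Library.Periodic_Fun"
begin

text \<open>
  A function on the torus \<open>\<real>/\<int> = [0,1)\<close> is rendered as a function on the reals of period 1
  (\<^locale>\<open>periodic_fun_simple'\<close>); the measure on the torus is Lebesgue measure restricted to
  the fundamental domain \<open>[0,1)\<close>.
\<close>

definition riemann_mean :: "nat \<Rightarrow> (real \<Rightarrow> real) \<Rightarrow> real \<Rightarrow> real" where
  "riemann_mean n f x = (1 / real n) * (\<Sum>k<n. f (x + real k / real n))"

text \<open>
  This is a class of functions, not of functions modulo null sets, so that pointwise statements
  about its members make sense. Since \<open>\<phi>\<close> takes values in \<open>[0,\<infinity>)\<close>,
  \<open>\<phi>(|f|) \<in> L\<^sup>1\<close> is integrability of \<open>\<phi>(|f|)\<close> itself.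
\<close>

definition L_phi :: "(real \<Rightarrow> real) \<Rightarrow> (real \<Rightarrow> real) set" where
  "L_phi \<phi> = {f. periodic_fun_simple' f
                \<and> f \<in> borel_measurable (lebesgue_on {0..<1})
                \<and> integrable (lebesgue_on {0..<1}) (\<lambda>x. \<phi> \<bar>f x\<bar>)}"

text \<open>The index starts at 1: \<open>prime_seq 1 = 2\<close>, \<open>prime_seq 2 = 3\<close>. The value at 0 is never used.\<close>

definition prime_seq :: "nat \<Rightarrow> nat" where
  "prime_seq i = enumerate {p. prime p} (i - 1)"

definition E_set :: "nat set" where
  "E_set = {(\<Prod>i\<in>{1..k} - {j}. prime_seq i) | k j. 2 \<le> k \<and> 1 \<le> j \<and> j \<le> k}"

text \<open>
  The elements of \<^const>\<open>E_set\<close> in increasing order, indexed from 0. The set is infinite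
  (shown below), so this is a strictly increasing sequence with range \<^const>\<open>E_set\<close>.
\<close>

definition n_seq :: "nat \<Rightarrow> nat" where
  "n_seq k = enumerate E_set k"

lemma prime_prime_seq: "prime (prime_seq i)"
  using enumerate_in_set[OF primes_infinite] by (simp add: prime_seq_def)

lemma infinite_E_set: "infinite E_set"
proof -
  have "\<exists>n>m. n \<in> E_set" for m
  proof -
    define k where "k = m + 2"
    let ?P = "\<Prod>i\<in>{1..k} - {1}. prime_seq i"
    have "?P \<in> E_set"
      unfolding E_set_def k_def by force
    moreover have "prime_seq k dvd ?P"
      by (rule dvd_prodI) (auto simp: k_def)
    then have "prime_seq k \<le> ?P"
      by (rule dvd_imp_le) (auto intro!: prod_pos prime_gt_0_nat prime_prime_seq)
    moreover have "m + 1 \<le> prime_seq k"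
      using le_enumerate[OF primes_infinite, of "m + 1"] by (simp add: prime_seq_def k_def)
    ultimately show ?thesis
      by (intro exI[of _ ?P]) auto
  qed
  then show ?thesis
    by (simp add: infinite_nat_iff_unbounded)
qed

lemma strict_mono_n_seq: "strict_mono n_seq"
  by (simp add: strict_mono_def n_seq_def infinite_E_set)

lemma range_n_seq: "range n_seq = E_set"
  using range_enumerate[OF infinite_E_set] by (simp add: n_seq_def)

end

theory Submission
  imports Defs "HOL-Number_Theory.Cong"
begin

text \<open>
  Let \<open>P\<close> be the product of the first \<open>k\<close> primes and write \<open>u = \<lfloor>P x\<rfloor>\<close>. For a function of \<open>x\<close> that
  depends on \<open>u mod P\<close> only, the mean over the \<open>P/p\<close> translates averages over all residues of \<open>u\<close>
  except the one modulo \<open>p\<close>. Fix \<open>t\<close>, take a large \<open>r\<close> and choose \<open>r\<close> disjoint blocks of primes such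
  that \<open>u\<close> is divisible by some prime of a given block with probability \<open>\<approx> t/r\<close>; such blocks exist
  because \<open>\<Prod>(1 - 1/p) = 0\<close>. Let \<open>A\<close> be the event that every block contains a prime divisor of \<open>u\<close>,
  of probability \<open>\<approx> (t/r)^r\<close>, and let \<open>N = M (r/t)^(r-1)\<close>. As soon as a single prime \<open>p\<close> of the blocks
  divides \<open>u\<close>, which fails with probability at most \<open>exp (-t)\<close>, the mean of \<open>N 1\<^sub>A\<close> over the \<open>P/p\<close>
  translates is about \<open>M\<close>. On the other hand \<open>ln N / ln ln N\<close> is of order \<open>r\<close>, so
  \<open>\<phi>(N) |A| = o(N |A| r) = o(M t)\<close>.

  With the supremum of such functions over stages \<open>M \<rightarrow> \<infinity>\<close> of small error, Borel--Cantelli gives unbounded means off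
  a null set, which may be taken invariant under rational translations. On that null set the
  function is redefined to enumerate each coset of \<open>\<rat>/\<int>\<close> injectively by natural numbers; then the
  mean over \<open>n\<close> distinct points is at least \<open>(n - 1)/2\<close>.
\<close>

section \<open>Blocks of primes\<close>

text \<open>A finite form of the Euler product: \<open>n = p ^ e n * m n\<close> encodes
  \<open>n\<close> injectively by a pair, so the sum is bounded by a geometric series in
  \<open>1 / p\<close> times a sum over numbers with prime factors in \<open>S\<close>, to which
  induction applies.\<close>

lemma sum_inverse_smooth_le:
  fixes S A :: "nat set"
  assumes "finite S" "\<And>p. p \<in> S \<Longrightarrow> prime p"
    and "finite A" "\<And>n. n \<in> A \<Longrightarrow> n > 0 \<and> prime_factors n \<subseteq> S"
  shows "(\<Sum>n\<in>A. 1 / real n) \<le> (\<Prod>p\<in>S. 1 / (1 - 1 / real p))"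
  using assms
proof (induction S arbitrary: A rule: finite_induct)
  case empty
  have "A \<subseteq> {1}"
    using empty by (auto simp: prime_factorization_empty_iff)
  then have "A = {} \<or> A = {1}" by auto
  then show ?case by auto
next
  case (insert p S)
  have p: "prime p" using insert by auto
  then have p1: "real p > 1" using prime_gt_1_nat[OF p] by simp
  define e m where "e = multiplicity p" and "m = (\<lambda>n. n div p ^ e n)"
  have dec: "n = p ^ e n * m n" for n
    unfolding e_def m_def by (simp add: multiplicity_dvd)
  define K where "K = Max (insert 0 (e ` A))"
  have K: "e n \<le> K" if "n \<in> A" for n
    unfolding K_def using that insert by (intro Max_ge) auto
  have m: "m n > 0 \<and> prime_factors (m n) \<subseteq> S" if "n \<in> A" for n
  proof -
    have n: "n > 0" "prime_factors n \<subseteq> insert p S" using insert that by auto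
    have m0: "m n > 0" using dec[of n] n by (metis mult_0_right not_gr0)
    have "\<not> p dvd m n"
      using n p unfolding m_def e_def
      by (metis multiplicity_decompose not_prime_unit not_less0)
    moreover have "prime_factors (m n) \<subseteq> prime_factors n"
      using n dec[of n] by (intro dvd_prime_factors) (auto, metis dvd_triv_right)
    ultimately show ?thesis using n m0 by (auto simp: in_prime_factors_iff)
  qed
  have inj: "inj_on (\<lambda>n. (e n, m n)) A"
    by (rule inj_onI) (metis dec prod.inject)
  have "(\<Sum>n\<in>A. 1 / real n) = (\<Sum>n\<in>A. (\<lambda>(i, k). (1 / real p) ^ i * (1 / real k)) (e n, m n))"
  proof (rule sum.cong)
    fix n
    have "real n = real p ^ e n * real (m n)"
      using dec[of n] by (metis of_nat_mult of_nat_power)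
    then show "1 / real n = (case (e n, m n) of (i, k) \<Rightarrow> (1 / real p) ^ i * (1 / real k))"
      by (simp add: power_one_over)
  qed simp
  also have "\<dots> = sum (\<lambda>(i, k). (1 / real p) ^ i * (1 / real k)) ((\<lambda>n. (e n, m n)) ` A)"
    using inj by (subst sum.reindex) (simp_all add: o_def)
  also have "\<dots> \<le> sum (\<lambda>(i, k). (1 / real p) ^ i * (1 / real k)) ({..K} \<times> m ` A)"
    using \<open>finite A\<close> K by (intro sum_mono2) auto
  also have "\<dots> = (\<Sum>i\<le>K. (1 / real p) ^ i) * (\<Sum>k\<in>m ` A. 1 / real k)"
    by (simp add: sum_product sum.cartesian_product)
  also have "\<dots> \<le> (1 / (1 - 1 / real p)) * (\<Prod>q\<in>S. 1 / (1 - 1 / real q))"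
  proof (rule mult_mono)
    show "(\<Sum>i\<le>K. (1 / real p) ^ i) \<le> 1 / (1 - 1 / real p)"
      using p1 sum_le_suminf[OF summable_geometric, of "1 / real p" "{..K}"] suminf_geometric[of "1 / real p"]
      by simp
    show "(\<Sum>k\<in>m ` A. 1 / real k) \<le> (\<Prod>q\<in>S. 1 / (1 - 1 / real q))"
      by (rule insert.IH) (use insert.prems(1,2) m in auto)
  qed (use p1 in \<open>auto intro: sum_nonneg\<close>)
  also have "\<dots> = (\<Prod>q\<in>insert p S. 1 / (1 - 1 / real q))"
    using insert.hyps by simp
  finally show ?case .
qed

lemma one_minus_inverse_prime_pos: "prime p \<Longrightarrow> 0 < 1 - 1 / real p"
  using prime_gt_1_nat[of p] by simp

text \<open>The Euler product bounds the harmonic sum up to \<open>z\<close> by the reciprocal of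
  the product over primes up to \<open>z\<close>, so divergence of the former drives the latter
  product to 0. The primes up to \<open>y\<close> contribute only the fixed positive factor
  \<open>c\<close>.\<close>

lemma exists_prod_primes_less:
  fixes \<epsilon> :: real and y :: nat
  assumes "\<epsilon> > 0"
  shows "\<exists>x. (\<Prod>p | prime p \<and> y < p \<and> p \<le> x. 1 - 1 / real p) < \<epsilon>"
proof -
  define c where "c = (\<Prod>p | prime p \<and> p \<le> y. 1 - 1 / real p)"
  have c: "c > 0"
    unfolding c_def by (intro prod_pos) (auto intro: one_minus_inverse_prime_pos[simplified])
  have "\<exists>x. harm x > 1 / (\<epsilon> * c)"
    using harm_at_top
    by (metis (full_types) eventually_gt_at_top eventually_sequentially filterlim_at_top_dense le_refl)
  then obtain x where x: "harm x > 1 / (\<epsilon> * c)" by blast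
  define Q where "Q = (\<lambda>x. \<Prod>p | prime p \<and> p \<le> x. 1 - 1 / real p)"
  have Q: "Q z > 0" for z
    unfolding Q_def by (intro prod_pos) (auto intro: one_minus_inverse_prime_pos[simplified])
  define z where "z = max x y"
  have "(harm x :: real) \<le> harm z"
    by (intro harm_mono) (simp add: z_def)
  also have "\<dots> = (\<Sum>n\<in>{1..z}. 1 / real n)"
    by (simp add: harm_def inverse_eq_divide)
  also have "\<dots> \<le> (\<Prod>p | prime p \<and> p \<le> z. 1 / (1 - 1 / real p))"
    by (intro sum_inverse_smooth_le)
       (auto simp: in_prime_factors_iff dest!: dvd_imp_le)
  also have "\<dots> = 1 / Q z"
    by (simp add: Q_def prod_dividef)
  finally have "1 / (\<epsilon> * c) < 1 / Q z" using x by simp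
  then have "Q z < \<epsilon> * c"
    using Q[of z] c assms by (simp add: field_simps)
  moreover have "Q z = c * (\<Prod>p | prime p \<and> y < p \<and> p \<le> z. 1 - 1 / real p)"
    unfolding Q_def c_def by (subst prod.union_disjoint[symmetric]) (auto simp: z_def intro!: prod.cong)
  ultimately show ?thesis using c by (auto simp: mult.commute intro!: exI[of _ z])
qed

text \<open>Primes above \<open>y\<close> are added one at a time until the product first drops to
  at most \<open>1 - a\<close>. Each exceeds \<open>1 / a\<close>, so the last one lowers the
  product by at most \<open>a\<close>, and it stays above \<open>1 - 2 * a\<close>.\<close>

lemma exists_prime_block:
  fixes a :: real and y :: nat
  assumes "0 < a" "a < 1" "1 / a \<le> real y"
  shows "\<exists>G. finite G \<and> (\<forall>p\<in>G. prime p \<and> y < p) \<and>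
    a \<le> 1 - (\<Prod>p\<in>G. 1 - 1 / real p) \<and> 1 - (\<Prod>p\<in>G. 1 - 1 / real p) \<le> 2 * a"
proof -
  define S where "S = (\<lambda>x. {p. prime p \<and> y < p \<and> p \<le> x})"
  define h where "h = (\<lambda>x. \<Prod>p\<in>S x. 1 - 1 / real p)"
  have fin: "finite (S x)" for x unfolding S_def by auto
  define x where "x = (LEAST x. h x \<le> 1 - a)"
  have "\<exists>x. h x \<le> 1 - a"
    using exists_prod_primes_less[of "1 - a" y] assms unfolding h_def S_def
    by (auto intro: less_imp_le)
  then have x: "h x \<le> 1 - a" unfolding x_def by (rule LeastI_ex)
  have "x \<noteq> 0"
  proof
    assume "x = 0"
    then have "S x = {}" by (auto simp: S_def)
    then show False using x assms by (simp add: h_def)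
  qed
  then obtain w where w: "x = Suc w" by (cases x) auto
  have "\<not> h w \<le> 1 - a"
    using not_less_Least[of w "\<lambda>x. h x \<le> 1 - a"] w x_def by auto
  moreover have "h x \<ge> h w - a"
  proof (cases "prime x \<and> y < x")
    case True
    have "S x = insert x (S w)" "x \<notin> S w" using w True by (auto simp: S_def)
    then have eq: "h x = (1 - 1 / real x) * h w"
      using fin by (simp add: h_def)
    have "h w \<le> 1"
      unfolding h_def by (intro prod_le_1)
        (auto simp: S_def intro: less_imp_le[OF one_minus_inverse_prime_pos, simplified])
    moreover have "h w \<ge> 0"
      unfolding h_def by (intro prod_nonneg)
        (auto simp: S_def intro: less_imp_le[OF one_minus_inverse_prime_pos, simplified])
    moreover have "1 / real x \<le> a"
    proof -
      have "1 / a \<le> real x" using True assms(3) by linarith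
      then show ?thesis using assms True by (simp add: field_simps)
    qed
    ultimately have "1 / real x * h w \<le> a * 1" 
      using assms by (intro mult_mono) auto
    then show ?thesis using eq by (simp add: algebra_simps)
  next
    case False
    then have "S x = S w" using w by (auto simp: S_def le_Suc_eq)
    then show ?thesis using assms by (simp add: h_def)
  qed
  ultimately show ?thesis
    using x fin[of x] unfolding h_def by (intro exI[of _ "S x"]) (auto simp: S_def)
qed

lemma exists_prime_blocks:
  fixes a :: real and r :: nat
  assumes "0 < a" "a < 1"
  shows "\<exists>G. \<forall>b<r. finite (G b) \<and> (\<forall>p\<in>G b. prime p) \<and> (\<forall>c<b. G b \<inter> G c = {}) \<and>
    a \<le> 1 - (\<Prod>p\<in>G b. 1 - 1 / real p) \<and> 1 - (\<Prod>p\<in>G b. 1 - 1 / real p) \<le> 2 * a"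
proof (induction r)
  case 0
  then show ?case by simp
next
  case (Suc r)
  define good where "good = (\<lambda>G. finite G \<and> (\<forall>p\<in>G. prime p) \<and>
    a \<le> 1 - (\<Prod>p\<in>G. 1 - 1 / real p) \<and> 1 - (\<Prod>p\<in>G. 1 - 1 / real p) \<le> 2 * a)"
  obtain G where G: "\<And>b. b < r \<Longrightarrow> good (G b)" "\<And>b c. b < r \<Longrightarrow> c < b \<Longrightarrow> G b \<inter> G c = {}"
  proof -
    from Suc obtain G where "\<forall>b<r. finite (G b) \<and> (\<forall>p\<in>G b. prime p) \<and> (\<forall>c<b. G b \<inter> G c = {}) \<and>
      a \<le> 1 - (\<Prod>p\<in>G b. 1 - 1 / real p) \<and> 1 - (\<Prod>p\<in>G b. 1 - 1 / real p) \<le> 2 * a"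
      by (rule exE)
    then show thesis by (intro that[of G]) (simp_all add: good_def)
  qed
  \<comment> \<open>Primes beyond \<open>y\<close> lie in no earlier block, which gives
    disjointness; \<open>y\<close> also meets the size condition of
    \<open>exists_prime_block\<close>.\<close>
  define y where "y = max (nat \<lceil>1 / a\<rceil>) (Max (insert 0 (\<Union>b<r. G b)))"
  have "1 / a \<le> real y" unfolding y_def by linarith
  then obtain H where H: "good H" "\<forall>p\<in>H. y < p"
    using exists_prime_block[of a y] assms unfolding good_def by blast
  have fin: "finite (\<Union>b<r. G b)"
    using G(1) by (auto simp: good_def)
  have "p \<le> y" if "b < r" "p \<in> G b" for b p
    unfolding y_def by (rule max.coboundedI2, rule Max_ge) (use that fin in auto)
  then have HG: "H \<inter> G b = {}" if "b < r" for b
    using H(2) that by (meson disjoint_iff leD)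
  define G' where "G' = G(r := H)"
  have "good (G' b) \<and> (\<forall>c<b. G' b \<inter> G' c = {})" if "b < Suc r" for b
  proof (cases "b = r")
    case True
    then show ?thesis using H HG by (simp add: G'_def)
  next
    case False
    then have "b < r" using that by simp
    then show ?thesis using G[of b] by (simp add: G'_def)
  qed
  then show ?case by (intro exI[of _ G']) (simp add: good_def)
qed

section \<open>Densities of periodic sets of integers\<close>

definition mod_periodic :: "nat \<Rightarrow> int set \<Rightarrow> bool" where
  "mod_periodic m A \<longleftrightarrow> (\<forall>u. u mod int m \<in> A \<longleftrightarrow> u \<in> A)"

definition dens :: "nat \<Rightarrow> int set \<Rightarrow> real" where
  "dens m A = real (card (A \<inter> {0..<int m})) / real m"

lemma mod_periodic_dvd:
  assumes "mod_periodic m A" "m dvd n"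
  shows "mod_periodic n A"
  using assms unfolding mod_periodic_def
  by (metis int_dvd_int_iff mod_mod_cancel)

lemma mod_periodic_Compl: "mod_periodic m A \<Longrightarrow> mod_periodic m (- A)"
  unfolding mod_periodic_def by auto

lemma mod_periodic_INT:
  assumes "\<And>i. i \<in> I \<Longrightarrow> mod_periodic m (A i)"
  shows "mod_periodic m (\<Inter>i\<in>I. A i)"
  using assms unfolding mod_periodic_def by auto

lemma dens_Compl:
  assumes "m > 0"
  shows "dens m (- A) = 1 - dens m A"
proof -
  have "- A \<inter> {0..<int m} = {0..<int m} - A \<inter> {0..<int m}" by auto
  then have "card (- A \<inter> {0..<int m}) + card (A \<inter> {0..<int m}) = m"
    by (simp add: card_Diff_subset card_mono[of "{0..<int m}" "A \<inter> {0..<int m}", simplified])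
  then have "real (card (- A \<inter> {0..<int m})) = real m - real (card (A \<inter> {0..<int m}))"
    by linarith
  then show ?thesis using assms by (simp add: dens_def field_simps)
qed

lemma bij_betw_add_mod:
  assumes "m > 0"
  shows "bij_betw (\<lambda>k. (v + int k) mod int m) {..<m} {0..<int m}"
proof -
  have inj: "inj_on (\<lambda>k. (v + int k) mod int m) {..<m}"
  proof (rule inj_onI)
    fix j k assume jk: "j \<in> {..<m}" "k \<in> {..<m}" "(v + int j) mod int m = (v + int k) mod int m"
    then have "[v + int j = v + int k] (mod int m)" by (simp add: cong_def)
    then have "[int j = int k] (mod int m)" by (simp add: cong_add_lcancel)
    then show "j = k" using jk by (auto simp: cong_def)
  qed
  moreover have "(\<lambda>k. (v + int k) mod int m) ` {..<m} = {0..<int m}"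
    using assms inj by (intro card_subset_eq) (auto simp: card_image)
  ultimately show ?thesis by (simp add: bij_betw_def)
qed

text \<open>Any \<open>m\<close> consecutive integers represent every residue once. This evaluates a
  Riemann mean whatever its starting point \<open>v\<close>.\<close>

lemma card_shift_eq_dens:
  assumes "mod_periodic m A" "m > 0"
  shows "real (card {k\<in>{..<m}. v + int k \<in> A}) = real m * dens m A"
proof -
  have "bij_betw (\<lambda>k. (v + int k) mod int m) {k\<in>{..<m}. v + int k \<in> A} (A \<inter> {0..<int m})"
  proof (rule bij_betw_subset[OF bij_betw_add_mod[OF assms(2), of v]])
    have "(\<lambda>k. (v + int k) mod int m) ` {k\<in>{..<m}. (v + int k) mod int m \<in> A} =
        A \<inter> (\<lambda>k. (v + int k) mod int m) ` {..<m}"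
      by auto
    then show "(\<lambda>k. (v + int k) mod int m) ` {k\<in>{..<m}. v + int k \<in> A} = A \<inter> {0..<int m}"
      using assms(1) bij_betw_imp_surj_on[OF bij_betw_add_mod[OF assms(2), of v]]
      by (simp add: mod_periodic_def)
  qed auto
  then show ?thesis
    using assms(2) by (simp add: dens_def bij_betw_same_card)
qed

text \<open>Division by \<open>m\<close> splits a period of length \<open>m * d\<close> into
  \<open>d\<close> copies of one of length \<open>m\<close>; the density is thus independent of the
  period chosen.\<close>

lemma dens_mult:
  assumes "mod_periodic m A" "m > 0" "d > 0"
  shows "dens (m * d) A = dens m A"
proof -
  have "bij_betw (\<lambda>u. (u div int m, u mod int m)) (A \<inter> {0..<int (m * d)}) ({0..<int d} \<times> (A \<inter> {0..<int m}))"
  proof (rule bij_betw_byWitness[where f' = "\<lambda>(q, s). q * int m + s"])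
    show "(\<lambda>u. (u div int m, u mod int m)) ` (A \<inter> {0..<int (m * d)}) \<subseteq> {0..<int d} \<times> (A \<inter> {0..<int m})"
    proof -
      have "u div int m < int d" if "u < int (m * d)" for u
      proof -
        have "int m * (u div int m) \<le> u"
          using assms by (simp add: mult.commute minus_mod_eq_mult_div [symmetric])
        also have "\<dots> < int m * int d" using that by simp
        finally show ?thesis using assms by simp
      qed
      then show ?thesis
        using assms unfolding mod_periodic_def by (auto simp: pos_imp_zdiv_nonneg_iff)
    qed
    show "(\<lambda>(q, s). q * int m + s) ` ({0..<int d} \<times> (A \<inter> {0..<int m})) \<subseteq> A \<inter> {0..<int (m * d)}"
    proof safe
      fix q s assume qs: "q \<in> {0..<int d}" "s \<in> A" "s \<in> {0..<int m}"
      then show "q * int m + s \<in> A"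
        using assms(1) unfolding mod_periodic_def
        by (metis atLeastLessThan_iff mod_mult_self3 mod_pos_pos_trivial)
      have "q * int m + s < q * int m + int m" using qs by simp
      also have "\<dots> = (q + 1) * int m" by (simp add: algebra_simps)
      also have "\<dots> \<le> int d * int m" using qs by (intro mult_right_mono) auto
      finally show "q * int m + s \<in> {0..<int (m * d)}" using qs by (simp add: mult.commute)
    qed
  qed (use assms in auto)
  then have "card (A \<inter> {0..<int (m * d)}) = card ({0..<int d} \<times> (A \<inter> {0..<int m}))"
    by (rule bij_betw_same_card)
  then show ?thesis using assms by (simp add: dens_def card_cartesian_product)
qed

lemma dens_dvd:
  assumes "mod_periodic m A" "m dvd n" "n > 0"
  shows "dens n A = dens m A"
  using assms dens_mult[of m A] by (auto elim!: dvdE)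

text \<open>Chinese remainder theorem: the pair of residues is injective by coprimality, hence onto
  by counting. Events for coprime moduli are therefore independent.\<close>

lemma dens_Int_coprime:
  assumes "mod_periodic m A" "mod_periodic n B" "coprime m n" "m > 0" "n > 0"
  shows "dens (m * n) (A \<inter> B) = dens m A * dens n B"
proof -
  let ?g = "\<lambda>u. (u mod int m, u mod int n)"
  have inj: "inj_on ?g {0..<int (m * n)}"
  proof (rule inj_onI)
    fix u v assume uv: "u \<in> {0..<int (m * n)}" "v \<in> {0..<int (m * n)}" "?g u = ?g v"
    then have "[u = v] (mod int m)" "[u = v] (mod int n)" by (auto simp: cong_def)
    then have "[u = v] (mod int m * int n)"
      using assms by (intro coprime_cong_mult) auto
    then show "u = v" using uv by (auto simp: cong_def)
  qed
  have "?g ` {0..<int (m * n)} = {0..<int m} \<times> {0..<int n}"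
    using assms inj by (intro card_subset_eq) (auto simp: card_image card_cartesian_product nat_mult_distrib)
  then have "bij_betw ?g {0..<int (m * n)} ({0..<int m} \<times> {0..<int n})"
    using inj by (simp add: bij_betw_def)
  then have "bij_betw ?g (A \<inter> B \<inter> {0..<int (m * n)}) ((A \<inter> {0..<int m}) \<times> (B \<inter> {0..<int n}))"
  proof (rule bij_betw_subset)
    show "?g ` (A \<inter> B \<inter> {0..<int (m * n)}) = (A \<inter> {0..<int m}) \<times> (B \<inter> {0..<int n})" (is "?L = ?R")
    proof
      show "?L \<subseteq> ?R" using assms unfolding mod_periodic_def by auto
      show "?R \<subseteq> ?L"
      proof
        fix z assume z: "z \<in> ?R"
        then have "z \<in> ?g ` {0..<int (m * n)}"
          using \<open>?g ` {0..<int (m * n)} = {0..<int m} \<times> {0..<int n}\<close> by auto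
        then obtain u where u: "u \<in> {0..<int (m * n)}" "z = ?g u" by auto
        then have "u \<in> A" "u \<in> B" using z assms(1,2) unfolding mod_periodic_def by auto
        then show "z \<in> ?L" using u by auto
      qed
    qed
  qed auto
  then have "card (A \<inter> B \<inter> {0..<int (m * n)}) = card ((A \<inter> {0..<int m}) \<times> (B \<inter> {0..<int n}))"
    by (rule bij_betw_same_card)
  then show ?thesis by (simp add: dens_def card_cartesian_product)
qed

lemma dens_INT_coprime:
  assumes "finite I"
    and "\<And>i. i \<in> I \<Longrightarrow> mod_periodic (m i) (A i)"
    and "\<And>i. i \<in> I \<Longrightarrow> m i > 0"
    and "\<And>i j. i \<in> I \<Longrightarrow> j \<in> I \<Longrightarrow> i \<noteq> j \<Longrightarrow> coprime (m i) (m j)"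
  shows "mod_periodic (\<Prod>i\<in>I. m i) (\<Inter>i\<in>I. A i) \<and> dens (\<Prod>i\<in>I. m i) (\<Inter>i\<in>I. A i) = (\<Prod>i\<in>I. dens (m i) (A i))"
  using assms
proof (induction I rule: finite_induct)
  case empty
  then show ?case by (simp add: dens_def mod_periodic_def)
next
  case (insert i I)
  have IH: "mod_periodic (\<Prod>i\<in>I. m i) (\<Inter>i\<in>I. A i)"
      "dens (\<Prod>i\<in>I. m i) (\<Inter>i\<in>I. A i) = (\<Prod>i\<in>I. dens (m i) (A i))"
    using insert by auto
  have "mod_periodic (\<Prod>j\<in>insert i I. m j) (\<Inter>j\<in>insert i I. A j)"
    using insert.prems(1) insert.hyps
    by (intro mod_periodic_INT mod_periodic_dvd[OF insert.prems(1)] dvd_prodI) auto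
  moreover have "coprime (m i) (\<Prod>i\<in>I. m i)"
    using insert by (intro prod_coprime_right) auto
  then have "dens (m i * (\<Prod>i\<in>I. m i)) (A i \<inter> (\<Inter>i\<in>I. A i)) = (\<Prod>j\<in>insert i I. dens (m j) (A j))"
    using insert IH by (subst dens_Int_coprime) (auto intro!: prod_pos)
  ultimately show ?case using insert by auto
qed

lemma prod_dvd_if_pairwise_coprime:
  fixes f :: "'b \<Rightarrow> nat"
  assumes "finite I" "\<And>i. i \<in> I \<Longrightarrow> f i dvd m"
    and "\<And>i j. i \<in> I \<Longrightarrow> j \<in> I \<Longrightarrow> i \<noteq> j \<Longrightarrow> coprime (f i) (f j)"
  shows "(\<Prod>i\<in>I. f i) dvd m"
  using assms
proof (induction I rule: finite_induct)
  case (insert i I)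
  then have "coprime (f i) (\<Prod>i\<in>I. f i)"
    by (intro prod_coprime_right) auto
  then show ?case using insert by (simp add: divides_mult)
qed simp

section \<open>Divisibility by a prime of a given block, and independence of disjoint blocks\<close>

definition hits :: "nat set \<Rightarrow> int set" where
  "hits S = {u. \<exists>p\<in>S. int p dvd u}"

lemma mod_periodic_hits:
  assumes "\<And>p. p \<in> S \<Longrightarrow> p dvd m"
  shows "mod_periodic m (hits S)"
  using assms unfolding mod_periodic_def hits_def by (auto simp: dvd_mod_iff)

text \<open>Passing to the complement turns the union into an intersection: avoiding
  \<open>p\<close> has density \<open>1 - 1 / p\<close>, and these events are independent for
  distinct primes.\<close>

lemma dens_hits:
  assumes "finite S" "\<And>p. p \<in> S \<Longrightarrow> prime p" "\<And>p. p \<in> S \<Longrightarrow> p dvd m" "m > 0"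
  shows "dens m (hits S) = 1 - (\<Prod>p\<in>S. 1 - 1 / real p)"
proof -
  have single: "dens p (- hits {p}) = 1 - 1 / real p" if "prime p" for p
  proof -
    have "hits {p} \<inter> {0..<int p} = {0}"
      using prime_gt_0_nat[OF that] by (auto simp: hits_def dest: zdvd_imp_le)
    then show ?thesis
      using prime_gt_0_nat[OF that] by (subst dens_Compl) (auto simp: dens_def)
  qed
  have *: "mod_periodic (\<Prod>p\<in>S. p) (\<Inter>p\<in>S. - hits {p}) \<and>
      dens (\<Prod>p\<in>S. p) (\<Inter>p\<in>S. - hits {p}) = (\<Prod>p\<in>S. dens p (- hits {p}))"
    using assms by (intro dens_INT_coprime)
      (auto intro!: mod_periodic_Compl mod_periodic_hits primes_coprime prime_gt_0_nat)
  have dvd: "(\<Prod>p\<in>S. p) dvd m"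
    using assms by (intro prod_dvd_if_pairwise_coprime) (auto intro: primes_coprime)
  have eq: "(\<Inter>p\<in>S. - hits {p}) = - hits S" by (auto simp: hits_def)
  have "dens m (- hits S) = (\<Prod>p\<in>S. 1 - 1 / real p)"
    using * dens_dvd[OF _ dvd assms(4)] single assms(2) by (simp add: eq)
  then show ?thesis using dens_Compl[OF assms(4), of "hits S"] by simp
qed

text \<open>The products of the primes of disjoint blocks are coprime, so the events of hitting
  different blocks are independent.\<close>

lemma dens_INT_hits:
  assumes "finite I" "\<And>b. b \<in> I \<Longrightarrow> finite (G b)"
    and "\<And>b p. b \<in> I \<Longrightarrow> p \<in> G b \<Longrightarrow> prime p \<and> p dvd m" "m > 0"
    and "\<And>b c. b \<in> I \<Longrightarrow> c \<in> I \<Longrightarrow> b \<noteq> c \<Longrightarrow> G b \<inter> G c = {}"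
  shows "dens m (\<Inter>b\<in>I. hits (G b)) = (\<Prod>b\<in>I. 1 - (\<Prod>p\<in>G b. 1 - 1 / real p))"
proof -
  let ?m = "\<lambda>b. \<Prod>p\<in>G b. p"
  have pos: "?m b > 0" if "b \<in> I" for b
    using assms that by (intro prod_pos) (auto intro: prime_gt_0_nat)
  have cop: "coprime (?m b) (?m c)" if "b \<in> I" "c \<in> I" "b \<noteq> c" for b c
  proof (intro prod_coprime_left prod_coprime_right)
    fix p q assume "p \<in> G b" "q \<in> G c"
    then have "p \<noteq> q" "prime p" "prime q" using assms(3,5) that by blast+
    then show "coprime p q" by (simp add: primes_coprime)
  qed
  have *: "mod_periodic (\<Prod>b\<in>I. ?m b) (\<Inter>b\<in>I. hits (G b)) \<and>
      dens (\<Prod>b\<in>I. ?m b) (\<Inter>b\<in>I. hits (G b)) = (\<Prod>b\<in>I. dens (?m b) (hits (G b)))"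
    using assms pos cop
    by (intro dens_INT_coprime mod_periodic_hits) (auto intro!: dvd_prodI[of _ _ "\<lambda>p. p", simplified])
  have dvd: "(\<Prod>b\<in>I. ?m b) dvd m"
    using assms cop by (intro prod_dvd_if_pairwise_coprime) (auto intro: primes_coprime)
  have "dens (?m b) (hits (G b)) = 1 - (\<Prod>p\<in>G b. 1 - 1 / real p)" if "b \<in> I" for b
    using assms that pos by (intro dens_hits) (auto intro!: dvd_prodI[of _ _ "\<lambda>p. p", simplified])
  then show ?thesis using * dens_dvd[OF _ dvd assms(4)] by simp
qed

section \<open>A small set with large means\<close>

definition lift_set :: "nat \<Rightarrow> int set \<Rightarrow> real set" where
  "lift_set m A = {x. \<lfloor>real m * x\<rfloor> \<in> A}"

lemma borel_lift_set [measurable]: "lift_set m A \<in> sets borel"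
proof -
  have "(\<lambda>x. \<lfloor>real m * x\<rfloor>) \<in> borel \<rightarrow>\<^sub>M count_space UNIV"
    by measurable
  from measurable_sets[OF this, of A] show ?thesis
    by (simp add: lift_set_def vimage_def)
qed

lemma lift_set_add_one:
  assumes "mod_periodic m A"
  shows "x + 1 \<in> lift_set m A \<longleftrightarrow> x \<in> lift_set m A"
proof -
  have "\<lfloor>real m * (x + 1)\<rfloor> = \<lfloor>real m * x\<rfloor> + int m"
    by (simp add: algebra_simps)
  then show ?thesis
    using assms unfolding mod_periodic_def lift_set_def
    by (metis mem_Collect_eq mod_add_self2)
qed

text \<open>The unit interval is cut into \<open>m\<close> intervals of length \<open>1 / m\<close>
  on which the floor is constant, so measuring reduces to counting residues.\<close>

lemma measure_lift_set:
  assumes "m > 0"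
  shows "measure lebesgue (lift_set m A \<inter> {0..<1}) = dens m A"
proof -
  define I where "I = (\<lambda>u::int. {real_of_int u / real m..<(real_of_int u + 1) / real m})"
  have I: "x \<in> I u \<longleftrightarrow> \<lfloor>real m * x\<rfloor> = u" for x u
    using assms by (auto simp: I_def floor_eq_iff field_simps)
  have unit: "x \<in> {0..<1} \<longleftrightarrow> \<lfloor>real m * x\<rfloor> \<in> {0..<int m}" for x
  proof -
    have "0 \<le> x \<longleftrightarrow> 0 \<le> real m * x" using assms by (simp add: zero_le_mult_iff)
    moreover have "x < 1 \<longleftrightarrow> real m * x < real m * 1"
      using assms by (subst mult_less_cancel_left_pos) auto
    ultimately show ?thesis by (simp add: floor_less_iff)
  qed
  have eq: "lift_set m A \<inter> {0..<1} = (\<Union>u\<in>A \<inter> {0..<int m}. I u)"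
    unfolding set_eq_iff UN_iff I lift_set_def Int_iff mem_Collect_eq unit by blast
  have le: "real_of_int u / real m \<le> (real_of_int u + 1) / real m" for u
    by (intro divide_right_mono) auto
  have meas: "measure lebesgue (I u) = 1 / real m" for u
  proof -
    have "measure lebesgue (I u) = (real_of_int u + 1) / real m - real_of_int u / real m"
      using le[of u] unfolding I_def by simp
    then show ?thesis by (simp add: add_divide_distrib)
  qed
  have disj: "disjoint_family_on I (A \<inter> {0..<int m})"
    unfolding disjoint_family_on_def disjoint_iff I by simp
  have "emeasure lebesgue (I u) \<noteq> \<infinity>" for u
    using le[of u] unfolding I_def by simp
  then have "measure lebesgue (\<Union>u\<in>A \<inter> {0..<int m}. I u) = (\<Sum>u\<in>A \<inter> {0..<int m}. measure lebesgue (I u))"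
    using disj by (intro measure_finite_Union) (auto simp: I_def)
  then show ?thesis by (simp add: eq meas dens_def)
qed

text \<open>Since \<open>m / n = p\<close>, translating \<open>x\<close> by \<open>k / n\<close>
  moves the floor of \<open>m * x\<close> by exactly \<open>p * k\<close>. The mean thus counts
  members of \<open>A\<close> in an arithmetic progression of step \<open>p\<close>.\<close>

lemma riemann_mean_lift_set:
  assumes "m = n * p" "n > 0" "p > 0"
  shows "riemann_mean n (\<lambda>x. N * indicator (lift_set m A) x) x =
    N * real (card {k\<in>{..<n}. \<lfloor>real m * x\<rfloor> + int p * int k \<in> A}) / real n"
proof -
  have "\<lfloor>real m * (x + real k / real n)\<rfloor> = \<lfloor>real m * x\<rfloor> + int p * int k" for k
  proof -
    have "real m * (x + real k / real n) = real m * x + real_of_int (int p * int k)"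
      using assms by (simp add: field_simps)
    then show ?thesis by (simp only: floor_add_int[symmetric])
  qed
  then have "(\<Sum>k<n. N * indicator (lift_set m A) (x + real k / real n)) =
      N * (\<Sum>k<n. indicator {k. \<lfloor>real m * x\<rfloor> + int p * int k \<in> A} k)"
    by (simp add: lift_set_def indicator_def sum_distrib_left)
  also have "(\<Sum>k<n. indicator {k. \<lfloor>real m * x\<rfloor> + int p * int k \<in> A} k) =
      real (card {k\<in>{..<n}. \<lfloor>real m * x\<rfloor> + int p * int k \<in> A})"
    by (simp add: indicator_def sum.If_cases Int_def)
  finally show ?thesis by (simp add: riemann_mean_def)
qed

section \<open>Moduli adapted to \<open>E_set\<close>, and the block construction\<close>

lemma prime_in_range_prime_seq:
  assumes "prime p"
  shows "\<exists>i\<ge>1. prime_seq i = p"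
proof -
  obtain j where "enumerate {p::nat. prime p} j = p"
    using enumerate_Ex[of "{p::nat. prime p}" p] primes_infinite assms by auto
  then show ?thesis by (intro exI[of _ "Suc j"]) (simp add: prime_seq_def)
qed

text \<open>The product of sufficiently many initial primes contains all of \<open>J\<close>, and
  deleting any one factor leaves an element of \<open>E_set\<close>. This is how the shape of
  \<open>E_set\<close> enters: one modulus serves every \<open>p\<close> in
  \<open>J\<close>.\<close>

lemma exists_modulus_E_set:
  assumes "finite J" "\<And>p. p \<in> J \<Longrightarrow> prime p"
  shows "\<exists>m>0. \<forall>p\<in>J. \<exists>n\<in>E_set. m = n * p"
proof -
  have "\<forall>p\<in>J. \<exists>i\<ge>1. prime_seq i = p"
    using assms(2) prime_in_range_prime_seq by blast
  then obtain ix where ix: "\<And>p. p \<in> J \<Longrightarrow> ix p \<ge> 1 \<and> prime_seq (ix p) = p"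
    by (auto simp: bchoice_iff)
  \<comment> \<open>The entry 2 secures \<open>2 \<le> K\<close>, as \<open>E_set\<close>
    demands.\<close>
  define K where "K = Max (insert 2 (ix ` J))"
  have "2 \<le> K" unfolding K_def using assms(1) by (intro Max_ge) auto
  have K: "ix p \<le> K" if "p \<in> J" for p
    unfolding K_def using assms(1) that by (intro Max_ge) auto
  let ?m = "\<Prod>i\<in>{1..K}. prime_seq i"
  show ?thesis
  proof (intro exI[of _ ?m] conjI ballI)
    show "?m > 0" by (intro prod_pos) (auto intro: prime_gt_0_nat prime_prime_seq)
    fix p assume p: "p \<in> J"
    have "?m = prime_seq (ix p) * (\<Prod>i\<in>{1..K} - {ix p}. prime_seq i)"
      using ix[OF p] K[OF p] by (intro prod.remove) auto
    moreover have "(\<Prod>i\<in>{1..K} - {ix p}. prime_seq i) \<in> E_set"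
      unfolding E_set_def using ix[OF p] K[OF p] \<open>2 \<le> K\<close> by blast
    ultimately show "\<exists>n\<in>E_set. ?m = n * p"
      using ix[OF p] by (auto simp: mult.commute)
  qed
qed

lemma E_set_pos: "n \<in> E_set \<Longrightarrow> n > 0"
  unfolding E_set_def by clarify (rule prod_pos, rule prime_gt_0_nat, rule prime_prime_seq)

text \<open>\<open>A\<close> asks that every block hit the floor \<open>u\<close>, \<open>B\<close>
  only that some prime of some block divide it. If \<open>p\<close> in \<open>G b\<close> divides
  \<open>u\<close>, it divides every \<open>u + p * k\<close>, so block \<open>b\<close> is hit
  throughout the mean over \<open>n = m / p\<close> translates. Only the other blocks remain to be
  hit, and the factor \<open>a b\<close> of the density of \<open>A\<close> disappears.\<close>

lemma block_construction:
  fixes G :: "nat \<Rightarrow> nat set" and r :: nat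
  defines "a \<equiv> \<lambda>b. 1 - (\<Prod>p\<in>G b. 1 - 1 / real p)"
  assumes fin: "\<And>b. b < r \<Longrightarrow> finite (G b)"
    and pr: "\<And>b p. b < r \<Longrightarrow> p \<in> G b \<Longrightarrow> prime p"
    and disj: "\<And>b c. b < r \<Longrightarrow> c < r \<Longrightarrow> b \<noteq> c \<Longrightarrow> G b \<inter> G c = {}"
  shows "\<exists>m A B. m > 0 \<and> mod_periodic m A \<and> mod_periodic m B \<and>
    dens m A = (\<Prod>b<r. a b) \<and> dens m (- B) = (\<Prod>b<r. 1 - a b) \<and>
    (\<forall>N\<ge>0. \<forall>x\<in>lift_set m B. \<exists>n\<in>E_set. \<exists>b<r.
      N * (\<Prod>c\<in>{..<r} - {b}. a c) \<le> riemann_mean n (\<lambda>x. N * indicator (lift_set m A) x) x)"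
proof -
  define J where "J = (\<Union>b<r. G b)"
  have J: "finite J" "\<And>p. p \<in> J \<Longrightarrow> prime p" using fin pr by (auto simp: J_def)
  obtain m where m: "m > 0" "\<And>p. p \<in> J \<Longrightarrow> \<exists>n\<in>E_set. m = n * p"
    using exists_modulus_E_set[OF J] by blast
  have dvd: "p dvd m" if "p \<in> J" for p using m(2)[OF that] by auto
  define A where "A = (\<Inter>b\<in>{..<r}. hits (G b))"
  define B where "B = hits J"
  have perA: "mod_periodic m A"
    unfolding A_def using dvd by (intro mod_periodic_INT mod_periodic_hits) (auto simp: J_def)
  have perB: "mod_periodic m B"
    unfolding B_def using dvd by (intro mod_periodic_hits) auto
  have densA: "dens m A = (\<Prod>b<r. a b)"
    unfolding A_def a_def
  proof (rule dens_INT_hits)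
    fix b p assume "b \<in> {..<r}" "p \<in> G b"
    then show "prime p \<and> p dvd m" using pr[of b p] dvd[of p] unfolding J_def by blast
  qed (use fin disj m(1) in auto)
  have "dens m (- B) = (\<Prod>p\<in>J. 1 - 1 / real p)"
    unfolding B_def using dens_hits[OF J dvd m(1)] by (simp add: dens_Compl[OF m(1)])
  also have "\<dots> = (\<Prod>b<r. 1 - a b)"
    unfolding J_def a_def using fin disj by (subst prod.UNION_disjoint) auto
  finally have densB: "dens m (- B) = (\<Prod>b<r. 1 - a b)" .
  have main: "\<exists>n\<in>E_set. \<exists>b<r.
      N * (\<Prod>c\<in>{..<r} - {b}. a c) \<le> riemann_mean n (\<lambda>x. N * indicator (lift_set m A) x) x"
    if N: "N \<ge> 0" and x: "x \<in> lift_set m B" for N x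
  proof -
    define u where "u = \<lfloor>real m * x\<rfloor>"
    from x obtain b p where bp: "b < r" "p \<in> G b" "int p dvd u"
      unfolding lift_set_def B_def hits_def J_def u_def by auto
    then obtain v where v: "u = int p * v" by (auto elim: dvdE)
    have pJ: "p \<in> J" and pp: "prime p" using bp pr by (auto simp: J_def)
    obtain n where n: "n \<in> E_set" "m = n * p" using m(2)[OF pJ] by blast
    have n0: "n > 0" using E_set_pos[OF n(1)] .
    \<comment> \<open>Block \<open>b\<close> is left out, being hit by \<open>p\<close> already. The
      primes of the other blocks divide \<open>m\<close> and differ from \<open>p\<close>, hence
      divide \<open>n\<close>, which makes \<open>C\<close> periodic modulo
      \<open>n\<close>.\<close>
    define C where "C = (\<Inter>c\<in>{..<r} - {b}. hits (G c))"
    have dvdn: "q dvd n" if "c \<in> {..<r} - {b}" "q \<in> G c" for c q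
    proof -
      have "q \<noteq> p" using disj[of b c] bp that by auto
      then have "coprime q p" using pr that pp by (auto intro: primes_coprime)
      moreover have "q dvd n * p" using dvd[of q] that n(2) by (auto simp: J_def)
      ultimately show ?thesis by (simp add: coprime_dvd_mult_left_iff)
    qed
    have perC: "mod_periodic n C"
      unfolding C_def using dvdn by (intro mod_periodic_INT mod_periodic_hits) blast
    have densC: "dens n C = (\<Prod>c\<in>{..<r} - {b}. a c)"
      unfolding C_def a_def
      by (rule dens_INT_hits) (use fin pr dvdn disj n0 in auto)
    \<comment> \<open>Factoring out \<open>p\<close> turns the progression of step \<open>p\<close>
      into the consecutive integers \<open>v + k\<close>, a full period for
      \<open>C\<close>.\<close>
    have "u + int p * int k \<in> A" if "v + int k \<in> C" for k
      unfolding A_def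
    proof
      fix c assume c: "c \<in> {..<r}"
      have eq: "u + int p * int k = int p * (v + int k)" by (simp add: v algebra_simps)
      show "u + int p * int k \<in> hits (G c)"
      proof (cases "c = b")
        case True
        then show ?thesis unfolding eq hits_def using bp(2) by (intro CollectI bexI[of _ p]) simp_all
      next
        case False
        then have "v + int k \<in> hits (G c)" using that c by (auto simp: C_def)
        then show ?thesis unfolding eq hits_def by (auto intro: dvd_mult)
      qed
    qed
    then have "card {k\<in>{..<n}. v + int k \<in> C} \<le> card {k\<in>{..<n}. u + int p * int k \<in> A}"
      by (intro card_mono) auto
    then have "real n * dens n C \<le> real (card {k\<in>{..<n}. u + int p * int k \<in> A})"
      using card_shift_eq_dens[OF perC n0, of v] by linarith
    then have "N * (real n * dens n C) \<le> N * real (card {k\<in>{..<n}. u + int p * int k \<in> A})"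
      using N by (rule mult_left_mono)
    then have "N * dens n C \<le> N * real (card {k\<in>{..<n}. u + int p * int k \<in> A}) / real n"
      using n0 by (simp add: field_simps)
    then have "N * (\<Prod>c\<in>{..<r} - {b}. a c) \<le> riemann_mean n (\<lambda>x. N * indicator (lift_set m A) x) x"
      using riemann_mean_lift_set[OF n(2) n0 prime_gt_0_nat[OF pp]] by (simp add: densC u_def)
    then show ?thesis using n(1) bp(1) by blast
  qed
  show ?thesis using m(1) perA perB densA densB main by blast
qed

lemma small_set_with_large_means:
  fixes \<phi> :: "real \<Rightarrow> real" and M \<epsilon> :: real
  assumes lim: "((\<lambda>x. \<phi> x * ln (ln x) / (x * ln x)) \<longlongrightarrow> 0) at_top"
    and M: "M \<ge> 1" and \<epsilon>: "\<epsilon> > 0"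
  shows "\<exists>N A B. N \<ge> 0 \<and> A \<in> sets borel \<and> B \<in> sets borel \<and>
    (\<forall>x. x + 1 \<in> A \<longleftrightarrow> x \<in> A) \<and> (\<forall>x. x + 1 \<in> B \<longleftrightarrow> x \<in> B) \<and>
    measure lebesgue (A \<inter> {0..<1}) \<le> \<epsilon> \<and> \<phi> N * measure lebesgue (A \<inter> {0..<1}) \<le> \<epsilon> \<and>
    measure lebesgue (- B \<inter> {0..<1}) \<le> \<epsilon> \<and>
    (\<forall>x\<in>B. \<exists>n\<in>E_set. M \<le> riemann_mean n (\<lambda>x. N * indicator A x) x)"
proof -
  \<comment> \<open>\<open>exp (- t)\<close> will bound the measure of the set where no prime of the
    blocks divides; the lower bound 1 later gives \<open>1 / a \<le> r\<close>.\<close>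
  define t where "t = max 1 (ln (1 / \<epsilon>))"
  have t: "t \<ge> 1" by (simp add: t_def)
  have "exp (- t) \<le> exp (- ln (1 / \<epsilon>))" by (simp add: t_def)
  then have exp_t: "exp (- t) \<le> \<epsilon>" using \<epsilon> by (simp add: ln_div)
  \<comment> \<open>Chosen so that \<open>\<delta> * 2 * M * t = \<epsilon>\<close>, where the
    estimate of \<open>\<phi> N * D\<close> ends.\<close>
  define \<delta> where "\<delta> = \<epsilon> / (2 * M * t)"
  have \<delta>: "\<delta> > 0" using M t \<epsilon> by (simp add: \<delta>_def)
  have "eventually (\<lambda>x. \<phi> x * ln (ln x) / (x * ln x) < \<delta>) at_top"
    using lim \<delta> by (rule order_tendstoD)
  then obtain X where X: "\<And>x. x \<ge> X \<Longrightarrow> \<phi> x * ln (ln x) / (x * ln x) < \<delta>"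
    by (auto simp: eventually_at_top_linorder)
  \<comment> \<open>The entries secure in turn: \<open>ln r > 0\<close> and
    \<open>r \<le> 2 * (r - 1)\<close>; \<open>X \<le> N\<close>;
    \<open>exp 2 \<le> 1 / (2 * a)\<close>; \<open>N \<le> r ^ r\<close>;
    \<open>2 * a \<le> \<epsilon>\<close>; \<open>2 * a < 1\<close>.\<close>
  obtain r :: nat where r': "real r \<ge> Max {3, X, 2 * t * exp 2, 2 * M, 2 * t / \<epsilon>, 2 * t + 1}"
    using real_arch_simple by blast
  then have r: "real r \<ge> 3" "real r \<ge> X" "real r \<ge> 2 * t * exp 2" "real r \<ge> 2 * M"
    "real r \<ge> 2 * t / \<epsilon>" "real r > 2 * t"
    by auto
  define a where "a = t / real r"
  have a: "0 < a" "2 * a < 1" "a * real r = t" "2 * a \<le> \<epsilon>" "exp 2 \<le> 1 / (2 * a)"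
    using r t \<epsilon> by (auto simp: a_def field_simps)
  obtain G where G: "\<forall>b<r. finite (G b) \<and> (\<forall>p\<in>G b. prime p) \<and> (\<forall>c<b. G b \<inter> G c = {}) \<and>
    a \<le> 1 - (\<Prod>p\<in>G b. 1 - 1 / real p) \<and> 1 - (\<Prod>p\<in>G b. 1 - 1 / real p) \<le> 2 * a"
    using exists_prime_blocks[of a r] a by auto
  define q where "q = (\<lambda>b. 1 - (\<Prod>p\<in>G b. 1 - 1 / real p))"
  have q: "a \<le> q b" "q b \<le> 2 * a" if "b < r" for b
    using G that by (simp_all add: q_def)
  have disj: "G b \<inter> G c = {}" if "b < r" "c < r" "b \<noteq> c" for b c
    using G that by (metis inf_commute linorder_neqE_nat)
  have "\<exists>m A B. m > 0 \<and> mod_periodic m A \<and> mod_periodic m B \<and>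
    dens m A = (\<Prod>b<r. q b) \<and> dens m (- B) = (\<Prod>b<r. 1 - q b) \<and>
    (\<forall>N\<ge>0. \<forall>x\<in>lift_set m B. \<exists>n\<in>E_set. \<exists>b<r.
      N * (\<Prod>c\<in>{..<r} - {b}. q c) \<le> riemann_mean n (\<lambda>x. N * indicator (lift_set m A) x) x)"
    unfolding q_def by (rule block_construction) (use G in simp, use G in simp, rule disj)
  then obtain m A B where mAB': "m > 0 \<and> mod_periodic m A \<and> mod_periodic m B \<and>
    dens m A = (\<Prod>b<r. q b) \<and> dens m (- B) = (\<Prod>b<r. 1 - q b) \<and>
    (\<forall>N\<ge>0. \<forall>x\<in>lift_set m B. \<exists>n\<in>E_set. \<exists>b<r.
      N * (\<Prod>c\<in>{..<r} - {b}. q c) \<le> riemann_mean n (\<lambda>x. N * indicator (lift_set m A) x) x)"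
    by (elim exE) (rule that)
  then have mAB: "m > 0" "mod_periodic m A" "mod_periodic m B"
    "dens m A = (\<Prod>b<r. q b)" "dens m (- B) = (\<Prod>b<r. 1 - q b)"
    "\<And>N x. N \<ge> 0 \<Longrightarrow> x \<in> lift_set m B \<Longrightarrow> \<exists>n\<in>E_set. \<exists>b<r.
      N * (\<Prod>c\<in>{..<r} - {b}. q c) \<le> riemann_mean n (\<lambda>x. N * indicator (lift_set m A) x) x"
    by simp_all
  define D where "D = (\<Prod>b<r. q b)"
  have D_lower: "a ^ r \<le> D"
    using q a prod_mono[of "{..<r}" "\<lambda>_. a" q] by (simp add: D_def)
  have D_upper: "D \<le> (2 * a) ^ r"
    using q a prod_mono[of "{..<r}" q "\<lambda>_. 2 * a"] by (force simp: D_def)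
  have D: "D > 0" using D_lower a by (smt (verit) zero_less_power)
  obtain s where s: "r = Suc s" using r(1) by (cases r) auto
  \<comment> \<open>Since \<open>q b \<le> 2 * a\<close>, omitting the factor \<open>q b\<close> from \<open>D\<close> still leaves \<open>N * (D / q b) \<ge> M\<close>.\<close>
  define N where "N = 2 * a * M / D"
  have N0: "N > 0" using a M D by (simp add: N_def)
  have ND: "N * D = 2 * a * M" using D by (simp add: N_def)
  \<comment> \<open>\<open>N\<close> is at least the power \<open>r - 1\<close> of
    \<open>1 / (2 * a)\<close>, a number no smaller than \<open>exp 2\<close>; the 2 in the exponent
    makes up for the missing factor.\<close>
  have N_lower: "exp (real r) \<le> N"
  proof -
    have "exp (real r) \<le> exp (2 * real s)" using r(1) s by simp
    also have "\<dots> = exp 2 ^ s" by (simp add: exp_of_nat2_mult)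
    also have "\<dots> \<le> (1 / (2 * a)) ^ s" using a by (intro power_mono) auto
    also have "\<dots> = 2 * a / (2 * a) ^ r" using a by (simp add: s power_divide)
    also have "\<dots> \<le> 2 * a / D" using D_upper D a by (intro divide_left_mono) auto
    also have "\<dots> \<le> 2 * a * M / D" using M D a by (intro divide_right_mono) auto
    finally show ?thesis by (simp add: N_def)
  qed
  have N_upper: "N \<le> real r ^ r"
  proof -
    have "N \<le> 2 * a * M / a ^ r"
      unfolding N_def using D_lower a M D by (intro divide_left_mono) auto
    also have "\<dots> = 2 * M * (1 / a) ^ s" using a by (simp add: s power_divide)
    also have "\<dots> \<le> real r * real r ^ s"
    proof (intro mult_mono power_mono)
      show "1 / a \<le> real r" using t r(1) by (simp add: a_def field_simps)
    qed (use r a in auto)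
    finally show ?thesis by (simp add: s)
  qed
  \<comment> \<open>The two bounds on \<open>N\<close> give
    \<open>r \<le> ln N \<le> r * ln r\<close>, hence \<open>ln N / ln (ln N) \<le> r\<close>. The
    growth hypothesis then yields \<open>\<phi> N \<le> \<delta> * N * r\<close>, and multiplying by
    \<open>D\<close> leaves \<open>r\<close> only in the product \<open>a * r = t\<close>.\<close>
  have ln_N: "real r \<le> ln N" using N_lower N0 by (simp add: ln_ge_iff)
  have lnln: "ln (real r) \<le> ln (ln N)" using ln_N r(1) by simp
  have lnr: "ln (real r) > 0" using r(1) by simp
  have "ln N \<le> ln (real r ^ r)" using N_upper N0 r(1) by (simp add: ln_le_cancel_iff)
  also have "\<dots> = real r * ln (real r)" using r(1) by (simp add: ln_realpow)
  also have "\<dots> \<le> real r * ln (ln N)" using lnln by (simp add: mult_left_mono)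
  finally have ratio: "ln N \<le> real r * ln (ln N)" .
  have "X \<le> N" using r(2) N_lower exp_ge_add_one_self[of "real r"] by linarith
  moreover have "N * ln N > 0" using N0 ln_N r(1) by (intro mult_pos_pos) linarith+
  ultimately have "\<phi> N * ln (ln N) < \<delta> * (N * ln N)"
    using X[of N] by (simp add: pos_divide_less_eq)
  also have "\<dots> \<le> \<delta> * (N * (real r * ln (ln N)))"
    using ratio \<delta> N0 by (intro mult_left_mono) auto
  finally have "\<phi> N * ln (ln N) \<le> (\<delta> * N * real r) * ln (ln N)" by (simp add: mult_ac)
  then have "\<phi> N \<le> \<delta> * N * real r" using lnln lnr by (simp add: mult_le_cancel_right)
  then have "\<phi> N * D \<le> \<delta> * N * real r * D" using D by (intro mult_right_mono) auto
  also have "\<dots> = \<delta> * real r * (N * D)" by simp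
  also have "\<dots> = \<delta> * 2 * M * (a * real r)" unfolding ND by simp
  also have "\<dots> = \<epsilon>" unfolding a(3) using M t by (simp add: \<delta>_def)
  finally have \<phi>N: "\<phi> N * D \<le> \<epsilon>" .
  have "(2 * a) ^ s \<le> 1" using a by (intro power_le_one) auto
  then have "(2 * a) ^ r \<le> 2 * a" unfolding s power_Suc using a by (intro mult_left_le) auto
  then have D\<epsilon>: "D \<le> \<epsilon>" using D_upper a(4) by linarith
  \<comment> \<open>Each factor is at most \<open>1 - a \<le> exp (- a)\<close>, and over
    \<open>r\<close> blocks the exponents add up to \<open>- t\<close>.\<close>
  have "(\<Prod>b<r. 1 - q b) \<le> (\<Prod>b<r. exp (- a))"
  proof (intro prod_mono conjI)
    fix b assume "b \<in> {..<r}"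
    then have "a \<le> q b" "q b \<le> 2 * a" using q by auto
    then show "0 \<le> 1 - q b" "1 - q b \<le> exp (- a)"
      using a exp_ge_add_one_self[of "- a"] by linarith+
  qed
  also have "\<dots> = exp (- t)" using a(3) by (simp add: exp_of_nat_mult[symmetric] mult.commute)
  finally have comp: "(\<Prod>b<r. 1 - q b) \<le> \<epsilon>" using exp_t by simp
  have compl: "- lift_set m B = lift_set m (- B)" by (auto simp: lift_set_def)
  have large: "M \<le> N * (\<Prod>c\<in>{..<r} - {b}. q c)" if "b < r" for b
  proof -
    have qb: "0 < q b" "q b \<le> 2 * a" using q[OF that] a by auto
    have "D = q b * (\<Prod>c\<in>{..<r} - {b}. q c)"
      unfolding D_def using that by (intro prod.remove) auto
    then have "q b * (N * (\<Prod>c\<in>{..<r} - {b}. q c)) = 2 * a * M"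
      using ND by (simp add: mult_ac)
    then have "q b * M \<le> q b * (N * (\<Prod>c\<in>{..<r} - {b}. q c))"
      using qb M by (simp add: mult_right_mono)
    then show ?thesis using qb by simp
  qed
  show ?thesis
  proof (intro exI conjI allI ballI)
    show "N \<ge> 0" using N0 by simp
    show "lift_set m A \<in> sets borel" "lift_set m B \<in> sets borel" by measurable
    show "x + 1 \<in> lift_set m A \<longleftrightarrow> x \<in> lift_set m A" for x
      using mAB(2) by (rule lift_set_add_one)
    show "x + 1 \<in> lift_set m B \<longleftrightarrow> x \<in> lift_set m B" for x
      using mAB(3) by (rule lift_set_add_one)
    show "measure lebesgue (lift_set m A \<inter> {0..<1}) \<le> \<epsilon>"
      "\<phi> N * measure lebesgue (lift_set m A \<inter> {0..<1}) \<le> \<epsilon>"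
      using D\<epsilon> \<phi>N unfolding measure_lift_set[OF mAB(1)] mAB(4) D_def by simp_all
    show "measure lebesgue (- lift_set m B \<inter> {0..<1}) \<le> \<epsilon>"
      using comp unfolding compl measure_lift_set[OF mAB(1)] mAB(5) by simp
    fix x assume "x \<in> lift_set m B"
    then show "\<exists>n\<in>E_set. M \<le> riemann_mean n (\<lambda>x. N * indicator (lift_set m A) x) x"
      using mAB(6)[of N x] N0 large by (meson less_imp_le order_trans)
  qed
qed

section \<open>Enumerating the cosets of the rationals\<close>

definition coset_rep :: "real \<Rightarrow> real" where
  "coset_rep x = (SOME y. x - y \<in> \<rat>)"

text \<open>Injective modulo 1 on every coset of \<open>\<rat>\<close>, because \<^const>\<open>coset_rep\<close> is constant there.\<close>

definition coset_index :: "real \<Rightarrow> nat" where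
  "coset_index x = to_nat_on (\<rat> :: real set) (frac (x - coset_rep x))"

lemma coset_rep_Rats: "x - coset_rep x \<in> \<rat>"
  unfolding coset_rep_def by (rule someI[of "\<lambda>y. x - y \<in> \<rat>" x]) simp

text \<open>The choice operator is applied to the same predicate on both sides, so the two choices
  coincide.\<close>

lemma coset_rep_add_Rats:
  assumes "q \<in> \<rat>"
  shows "coset_rep (x + q) = coset_rep x"
proof -
  have "x + q - y \<in> \<rat> \<longleftrightarrow> x - y \<in> \<rat>" for y
    using Rats_add[of "x - y" q] Rats_diff[of "x + q - y" q] assms
    by (auto simp: algebra_simps)
  then show ?thesis by (simp add: coset_rep_def)
qed

lemma frac_Rats: "x \<in> \<rat> \<Longrightarrow> frac (x::real) \<in> \<rat>"
  by (simp add: frac_def)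

lemma coset_index_add_one: "coset_index (x + 1) = coset_index x"
proof -
  have "frac (x + 1 - coset_rep x) = frac (x - coset_rep x)"
    using frac_1_eq[of "x - coset_rep x"] by (simp add: algebra_simps)
  then show ?thesis by (simp add: coset_index_def coset_rep_add_Rats)
qed

text \<open>Equal indices mean equal fractional parts, so \<open>(j - k) / n\<close> is an integer;
  its absolute value is below 1.\<close>

lemma inj_on_coset_index:
  assumes "n > 0"
  shows "inj_on (\<lambda>k. coset_index (x + real k / real n)) {..<n}"
proof (rule inj_onI)
  let ?h = "\<lambda>k. coset_index (x + real k / real n)"
  fix j k assume jk: "j \<in> {..<n}" "k \<in> {..<n}" "?h j = ?h k"
  let ?c = "x - coset_rep x"
  have arg: "x + real i / real n - coset_rep (x + real i / real n) = ?c + real i / real n" for i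
    by (simp add: coset_rep_add_Rats)
  have R: "frac (?c + real i / real n) \<in> \<rat>" for i
    by (intro frac_Rats Rats_add coset_rep_Rats) simp
  have "to_nat_on \<rat> (frac (?c + real j / real n)) = to_nat_on \<rat> (frac (?c + real k / real n))"
    using jk(3) unfolding coset_index_def arg .
  then have "frac (?c + real j / real n) = frac (?c + real k / real n)"
    by (rule inj_onD[OF inj_on_to_nat_on[OF countable_rat]]) (rule R)+
  then have "(?c + real j / real n) - (?c + real k / real n) =
      of_int (\<lfloor>?c + real j / real n\<rfloor> - \<lfloor>?c + real k / real n\<rfloor>)"
    by (simp add: frac_def)
  then obtain i :: int where "(?c + real j / real n) - (?c + real k / real n) = of_int i"
    by (rule that)
  then have i: "(real j - real k) / real n = of_int i"
    by (simp add: diff_divide_distrib)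
  have "\<bar>real j - real k\<bar> < real n"
    using jk(1,2) by auto
  then have "\<bar>(real j - real k) / real n\<bar> < 1"
    using assms by simp
  then have "i = 0" using i by linarith
  then show "j = k" using i assms by simp
qed

text \<open>The sum of \<open>n\<close> distinct naturals is at least
  \<open>0 + 1 + ... + (n - 1)\<close>.\<close>

lemma riemann_mean_coset_index_ge:
  assumes "n > 0"
  shows "(real n - 1) / 2 \<le> riemann_mean n (\<lambda>x. real (coset_index x)) x"
proof -
  let ?h = "\<lambda>k. coset_index (x + real k / real n)"
  have "\<Sum> {0..<n} \<le> (\<Sum>k<n. ?h k)"
    using card_sum_le_nat_sum[of "?h ` {..<n}"] inj_on_coset_index[OF assms, of x]
    by (simp add: card_image sum.reindex)
  then have "real (\<Sum> {0..<n}) \<le> (\<Sum>k<n. real (?h k))"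
    by (metis of_nat_le_iff of_nat_sum)
  moreover have "real (\<Sum> {0..<n}) = real n * (real n - 1) / 2"
    by (induction n) (auto simp: field_simps)
  ultimately show ?thesis
    using assms by (simp add: riemann_mean_def field_simps)
qed

section \<open>Assembling the divergent function\<close>

lemma not_convergent_if_unbounded:
  fixes X :: "nat \<Rightarrow> real"
  assumes "\<And>K. \<exists>k. K \<le> X k"
  shows "\<not> convergent X"
proof
  assume "convergent X"
  then have "Bseq X" by (rule convergent_imp_Bseq)
  then obtain K where K: "\<And>k. norm (X k) \<le> K" by (auto simp: Bseq_def)
  obtain k where "K + 1 \<le> X k" using assms by blast
  then show False using K[of k] by simp
qed

lemma riemann_mean_mono:
  assumes "\<And>k. k < n \<Longrightarrow> f (x + real k / real n) \<le> g (x + real k / real n)"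
  shows "riemann_mean n f x \<le> riemann_mean n g x"
  unfolding riemann_mean_def by (intro mult_left_mono sum_mono) (use assms in auto)

lemma riemann_mean_cong:
  assumes "\<And>k. k < n \<Longrightarrow> f (x + real k / real n) = g (x + real k / real n)"
  shows "riemann_mean n f x = riemann_mean n g x"
  unfolding riemann_mean_def using assms by simp

lemma periodic_set_add_of_int:
  fixes S :: "real set"
  assumes "\<And>x. x + 1 \<in> S \<longleftrightarrow> x \<in> S"
  shows "x + of_int z \<in> S \<longleftrightarrow> x \<in> S"
proof -
  interpret periodic_fun_simple' "\<lambda>x. x \<in> S" by unfold_locales (rule assms)
  show ?thesis by (rule plus_of_int)
qed

text \<open>First Borel--Cantelli lemma; the factor 2 leaves room for two exceptional sets per
  stage.\<close>

lemma negligible_infinitely_often: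
  fixes C :: "nat \<Rightarrow> real set"
  assumes "\<And>i. C i \<in> sets lebesgue" "\<And>i. C i \<subseteq> {0..<1}" "\<And>i. measure lebesgue (C i) \<le> 2 * (1 / 2) ^ i"
  shows "negligible {x. \<not> (\<forall>\<^sub>F i in sequentially. x \<notin> C i)}"
proof -
  have fin: "emeasure lebesgue (C i) < \<infinity>" for i
  proof -
    have "emeasure lebesgue (C i) \<le> emeasure lebesgue {0..<1::real}"
      using assms(2) by (intro emeasure_mono) auto
    also have "\<dots> < \<infinity>" by simp
    finally show ?thesis .
  qed
  have sum: "summable (\<lambda>i. measure lebesgue (C i))"
    by (rule summable_comparison_test'[where g = "\<lambda>i. 2 * (1 / 2) ^ i" and N = 0])
       (use assms(3) in \<open>auto intro: summable_mult summable_geometric\<close>)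
  have "AE x in lebesgue. \<forall>\<^sub>F i in sequentially. x \<in> space lebesgue - C i"
    by (rule borel_cantelli_AE1) (use assms(1) fin sum in auto)
  then have "AE x in lebesgue. \<forall>\<^sub>F i in sequentially. x \<notin> C i" by simp
  then show ?thesis
    by (simp add: completion.AE_iff_null_sets negligible_iff_null_sets)
qed

text \<open>Only countably many translates of \<open>S\<close> are involved.\<close>

lemma negligible_Rats_saturation:
  fixes S :: "real set"
  assumes "negligible S"
  shows "negligible {x. \<exists>q\<in>\<rat>. x + q \<in> S}"
proof -
  have "negligible (\<Union>q\<in>\<rat>. (+) (- q) ` S)"
  proof (rule negligible_countable_Union)
    show "countable ((\<lambda>q. (+) (- q) ` S) ` \<rat>)" by (intro countable_image countable_rat)
    show "negligible T" if "T \<in> (\<lambda>q. (+) (- q) ` S) ` \<rat>" for T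
      using that negligible_translation[OF assms] by (elim imageE) (simp only:)
  qed
  moreover have "{x. \<exists>q\<in>\<rat>. x + q \<in> S} \<subseteq> (\<Union>q\<in>\<rat>. (+) (- q) ` S)"
  proof safe
    fix x q :: real assume "q \<in> \<rat>" "x + q \<in> S"
    then show "x \<in> (\<Union>q\<in>\<rat>. (+) (- q) ` S)"
      by (intro UN_I[of q] image_eqI[of _ _ "x + q"]) auto
  qed
  ultimately show ?thesis by (rule negligible_subset)
qed

theorem theorem3:
  fixes \<phi> :: "real \<Rightarrow> real"
  assumes "mono_on {0..} \<phi>"
    and "\<And>x. x \<ge> 0 \<Longrightarrow> \<phi> x \<ge> 0"
    and "((\<lambda>x. \<phi> x * ln (ln x) / (x * ln x)) \<longlongrightarrow> 0) at_top"
  shows "\<exists>f \<in> L_phi \<phi>. \<forall>x. \<not> convergent (\<lambda>k. riemann_mean (n_seq k) f x)"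
proof -
  let ?I = "{0..<1} :: real set"
  \<comment> \<open>Stage \<open>i\<close> demands means of height \<open>i + 1\<close> with
    summable error \<open>(1 / 2) ^ i\<close>.\<close>
  have "\<forall>i. \<exists>N A B. N \<ge> 0 \<and> A \<in> sets borel \<and> B \<in> sets borel \<and>
    (\<forall>x. x + 1 \<in> A \<longleftrightarrow> x \<in> A) \<and> (\<forall>x. x + 1 \<in> B \<longleftrightarrow> x \<in> B) \<and>
    measure lebesgue (A \<inter> ?I) \<le> (1 / 2) ^ i \<and> \<phi> N * measure lebesgue (A \<inter> ?I) \<le> (1 / 2) ^ i \<and>
    measure lebesgue (- B \<inter> ?I) \<le> (1 / 2) ^ i \<and>
    (\<forall>x\<in>B. \<exists>n\<in>E_set. real i + 1 \<le> riemann_mean n (\<lambda>x. N * indicator A x) x)"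
    by (rule allI, rule small_set_with_large_means[OF assms(3)]) auto
  then obtain N A B where "\<forall>i. N i \<ge> 0 \<and> A i \<in> sets borel \<and> B i \<in> sets borel \<and>
    (\<forall>x. x + 1 \<in> A i \<longleftrightarrow> x \<in> A i) \<and> (\<forall>x. x + 1 \<in> B i \<longleftrightarrow> x \<in> B i) \<and>
    measure lebesgue (A i \<inter> ?I) \<le> (1 / 2) ^ i \<and> \<phi> (N i) * measure lebesgue (A i \<inter> ?I) \<le> (1 / 2) ^ i \<and>
    measure lebesgue (- B i \<inter> ?I) \<le> (1 / 2) ^ i \<and>
    (\<forall>x\<in>B i. \<exists>n\<in>E_set. real i + 1 \<le> riemann_mean n (\<lambda>x. N i * indicator (A i) x) x)"
    unfolding choice_iff by (elim exE) (rule that)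
  then have N: "N i \<ge> 0" and [measurable]: "A i \<in> sets borel" "B i \<in> sets borel"
    and perA: "x + 1 \<in> A i \<longleftrightarrow> x \<in> A i" and perB: "x + 1 \<in> B i \<longleftrightarrow> x \<in> B i"
    and A: "measure lebesgue (A i \<inter> ?I) \<le> (1 / 2) ^ i" "\<phi> (N i) * measure lebesgue (A i \<inter> ?I) \<le> (1 / 2) ^ i"
    and B: "measure lebesgue (- B i \<inter> ?I) \<le> (1 / 2) ^ i"
    and large: "x \<in> B i \<Longrightarrow> \<exists>n\<in>E_set. real i + 1 \<le> riemann_mean n (\<lambda>x. N i * indicator (A i) x) x"
    for i x by simp_all
  have A_leb: "A i \<in> sets lebesgue" and B_leb: "B i \<in> sets lebesgue" for i
    by simp_all
  have AI: "A i \<inter> ?I \<in> sets lebesgue" and BI: "- B i \<inter> ?I \<in> sets lebesgue" for i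
  proof -
    have "- B i \<inter> ?I = ?I - B i" by auto
    then show "- B i \<inter> ?I \<in> sets lebesgue" using B_leb[of i] by (simp add: sets.Diff)
  qed (use A_leb in auto)
  \<comment> \<open>Avoiding \<open>A i\<close> eventually keeps the supremum finite; lying in
    \<open>B i\<close> eventually makes the means unbounded.\<close>
  define C where "C = (\<lambda>i. (A i \<inter> ?I) \<union> (- B i \<inter> ?I))"
  have C_leb: "C i \<in> sets lebesgue" for i
    unfolding C_def using AI BI by (rule sets.Un)
  have fin: "emeasure lebesgue S \<noteq> \<infinity>" if "S \<subseteq> ?I" for S
  proof -
    have "emeasure lebesgue S \<le> emeasure lebesgue ?I"
      using that by (intro emeasure_mono) auto
    also have "\<dots> < \<infinity>" by simp
    finally show ?thesis by simp
  qed
  have C_meas: "measure lebesgue (C i) \<le> 2 * (1 / 2) ^ i" for i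
  proof -
    have "measure lebesgue (C i) \<le> measure lebesgue (A i \<inter> ?I) + measure lebesgue (- B i \<inter> ?I)"
      unfolding C_def using AI BI by (rule measure_Un_le)
    then show ?thesis using A(1)[of i] B[of i] by linarith
  qed
  \<comment> \<open>Saturation under \<rat> puts all sample points \<open>x + k / n\<close> of a
    mean in \<open>Z\<close> or all of them outside.\<close>
  define Z where "Z = {x. \<exists>q\<in>\<rat>. x + q \<in> {x. \<not> (\<forall>\<^sub>F i in sequentially. x \<notin> C i)}}"
  have Z: "negligible Z"
    unfolding Z_def using C_leb C_meas
    by (intro negligible_Rats_saturation negligible_infinitely_often) (auto simp: C_def)
  then have Z_leb: "Z \<in> sets lebesgue" and Z_AE: "AE x in lebesgue. x \<notin> Z"
    using AE_not_in by (auto simp: negligible_iff_null_sets)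
  have Z_Rats: "x + q \<in> Z \<longleftrightarrow> x \<in> Z" if "q \<in> \<rat>" for x q
  proof
    assume "x + q \<in> Z"
    then obtain q' where "q' \<in> \<rat>" "\<not> (\<forall>\<^sub>F i in sequentially. x + q + q' \<notin> C i)" by (auto simp: Z_def)
    then show "x \<in> Z" unfolding Z_def using that by (auto intro!: bexI[of _ "q + q'"] simp: add.assoc)
  next
    assume "x \<in> Z"
    then obtain q' where "q' \<in> \<rat>" "\<not> (\<forall>\<^sub>F i in sequentially. x + q' \<notin> C i)" by (auto simp: Z_def)
    then show "x + q \<in> Z" unfolding Z_def using that by (auto intro!: bexI[of _ "q' - q"])
  qed
  have Z_step: "x + real k / real n \<in> Z \<longleftrightarrow> x \<in> Z" for x k n
    by (rule Z_Rats) simp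
  \<comment> \<open>\<open>C i\<close> lies in the unit interval, so \<open>x\<close> is moved there
    by an integer, which is rational, and the periodicity of \<open>A i\<close> and
    \<open>B i\<close> brings the conclusion back.\<close>
  have good: "\<forall>\<^sub>F i in sequentially. x \<notin> A i \<and> x \<in> B i" if "x \<notin> Z" for x
  proof -
    have fx: "frac x = x + of_int (- \<lfloor>x\<rfloor>)" by (simp add: frac_def)
    have "\<forall>\<^sub>F i in sequentially. x + of_int (- \<lfloor>x\<rfloor>) \<notin> C i"
      using that Rats_of_int unfolding Z_def by blast
    then show ?thesis
    proof eventually_elim
      case (elim i)
      have "frac x \<in> ?I" by (simp add: frac_lt_1)
      then have "frac x \<notin> A i" "frac x \<in> B i" using elim unfolding C_def fx by auto
      then show ?case
        unfolding fx periodic_set_add_of_int[of "A i", OF perA] periodic_set_add_of_int[of "B i", OF perB]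
        by simp
    qed
  qed
  \<comment> \<open>Removing \<open>Z\<close> makes every \<open>h i\<close> vanish there, so the
    supremum is a finite real everywhere.\<close>
  define h where "h = (\<lambda>i x. N i * indicator (A i - Z) x)"
  define g where "g = (\<lambda>x. SUP i. h i x)"
  have fin_range: "finite (range (\<lambda>i. h i x))" for x
  proof (cases "x \<in> Z")
    case True
    then have "range (\<lambda>i. h i x) \<subseteq> {0}" by (auto simp: h_def)
    then show ?thesis by (rule finite_subset) simp
  next
    case False
    from good[OF False] obtain i0 where i0: "\<And>i. i \<ge> i0 \<Longrightarrow> x \<notin> A i"
      by (auto simp: eventually_sequentially)
    have "h i x \<in> insert 0 (N ` {..<i0})" for i
      using i0[of i] by (cases "i < i0") (auto simp: h_def indicator_def)
    then have "range (\<lambda>i. h i x) \<subseteq> insert 0 (N ` {..<i0})" by blast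
    then show ?thesis by (rule finite_subset) simp
  qed
  then have bdd: "bdd_above (range (\<lambda>i. h i x))" for x by (rule bdd_above_finite)
  \<comment> \<open>The supremum is attained because each point sees finitely many values; hence
    \<open>\<phi>\<close> of it is controlled without continuity of \<open>\<phi>\<close>.\<close>
  have g_mem: "\<exists>i. g x = h i x" for x
    using Max_in[OF fin_range] cSup_eq_Max[OF fin_range] unfolding g_def by fastforce
  have h_le_g: "h i x \<le> g x" for i x
    unfolding g_def by (rule cSUP_upper) (auto intro: bdd)
  have h_nonneg: "h i x \<ge> 0" for i x using N by (simp add: h_def)
  have g_nonneg: "g x \<ge> 0" for x using h_nonneg h_le_g order_trans by blast
  have "A i - Z \<in> sets lebesgue" for i using A_leb Z_leb by (rule sets.Diff)
  then have "h i \<in> borel_measurable lebesgue" for i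
    unfolding h_def by measurable
  then have g_leb: "g \<in> borel_measurable lebesgue"
    unfolding g_def using bdd by (intro borel_measurable_cSUP) auto

  define f where "f = (\<lambda>x. if x \<in> Z then real (coset_index x) else g x)"
  \<comment> \<open>Measurability of \<open>coset_index\<close> is not claimed: \<open>f\<close>
    equals \<open>g\<close> off a null set, and Lebesgue measure is complete.\<close>
  have f_leb: "f \<in> borel_measurable lebesgue"
    by (rule borel_measurable_AE[OF g_leb]) (use Z_AE in \<open>auto simp: f_def elim: eventually_mono\<close>)
  have f_per: "f (x + 1) = f x" for x
  proof -
    have "x + 1 \<in> Z \<longleftrightarrow> x \<in> Z" by (rule Z_Rats) simp
    then show ?thesis by (simp add: f_def g_def h_def coset_index_add_one indicator_def perA)
  qed

  \<comment> \<open>Monotonicity of \<open>\<phi>\<close> is known on the nonnegative reals only;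
    truncation at 0 extends it to the whole line.\<close>
  have "mono (\<lambda>x. \<phi> (max 0 x))"
    using assms(1) by (intro monoI) (auto simp: mono_on_def)
  then have \<phi>_borel: "(\<lambda>x. \<phi> (max 0 x)) \<in> borel_measurable borel"
    by (rule borel_measurable_mono)
  have "(\<lambda>x. \<phi> (max 0 \<bar>f x\<bar>)) \<in> borel_measurable lebesgue"
    using f_leb by (intro measurable_compose[OF _ \<phi>_borel]) measurable
  then have \<phi>f: "(\<lambda>x. \<phi> \<bar>f x\<bar>) \<in> borel_measurable (lebesgue_on ?I)"
    by (intro measurable_restrict_space1) simp
  have emA: "emeasure (lebesgue_on ?I) (A i \<inter> ?I) = ennreal (measure lebesgue (A i \<inter> ?I))" for i
  proof -
    have "emeasure (lebesgue_on ?I) (A i \<inter> ?I) = emeasure lebesgue (A i \<inter> ?I)"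
      by (rule emeasure_restrict_space) auto
    then show ?thesis using fin[of "A i \<inter> ?I"] emeasure_eq_ennreal_measure[of lebesgue "A i \<inter> ?I"] by simp
  qed
  have A_on: "A i \<inter> ?I \<in> sets (lebesgue_on ?I)" for i
    using A_leb[of i] by (auto simp: sets_restrict_space)
  \<comment> \<open>Off \<open>Z\<close>, \<open>f x\<close> is either some \<open>N i\<close> with
    \<open>x\<close> in \<open>A i\<close>, or 0. The value \<open>\<phi> 0\<close> may be positive,
    but a constant is integrable on the unit interval.\<close>
  have pw: "ennreal (norm (\<phi> \<bar>f x\<bar>)) \<le>
      ennreal (\<phi> 0) + (\<Sum>i. ennreal (\<phi> (N i)) * indicator (A i \<inter> ?I) x)"
    if "x \<in> ?I" "x \<notin> Z" for x
  proof -
    obtain i where i: "g x = h i x" using g_mem by blast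
    show ?thesis
    proof (cases "x \<in> A i")
      case True
      then have "\<phi> \<bar>f x\<bar> = \<phi> (N i)" using that i N[of i] by (simp add: f_def h_def)
      then have "ennreal (norm (\<phi> \<bar>f x\<bar>)) = ennreal (\<phi> (N i)) * indicator (A i \<inter> ?I) x"
        using True that assms(2)[OF N] by simp
      also have "\<dots> \<le> (\<Sum>i. ennreal (\<phi> (N i)) * indicator (A i \<inter> ?I) x)"
      proof -
        have "T i \<le> suminf T" for T :: "nat \<Rightarrow> ennreal"
          using sum_le_suminf[of T "{i}"] by simp
        then show ?thesis .
      qed
      finally show ?thesis by (simp add: add_increasing)
    next
      case False
      then have "\<phi> \<bar>f x\<bar> = \<phi> 0" using that i by (simp add: f_def h_def)
      then show ?thesis using assms(2)[of 0] by simp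
    qed
  qed
  have "(\<integral>\<^sup>+ x. ennreal (norm (\<phi> \<bar>f x\<bar>)) \<partial>lebesgue_on ?I) \<le>
      (\<integral>\<^sup>+ x. ennreal (\<phi> 0) + (\<Sum>i. ennreal (\<phi> (N i)) * indicator (A i \<inter> ?I) x) \<partial>lebesgue_on ?I)"
  proof (rule nn_integral_mono_AE)
    show "AE x in lebesgue_on ?I. ennreal (norm (\<phi> \<bar>f x\<bar>)) \<le>
      ennreal (\<phi> 0) + (\<Sum>i. ennreal (\<phi> (N i)) * indicator (A i \<inter> ?I) x)"
    proof (subst AE_restrict_space_iff)
      show "?I \<inter> space lebesgue \<in> sets lebesgue" by simp
      show "AE x in lebesgue. x \<in> ?I \<longrightarrow> ennreal (norm (\<phi> \<bar>f x\<bar>)) \<le>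
        ennreal (\<phi> 0) + (\<Sum>i. ennreal (\<phi> (N i)) * indicator (A i \<inter> ?I) x)"
        using Z_AE by eventually_elim (intro impI pw)
    qed
  qed
  also have "\<dots> = (\<integral>\<^sup>+ x. ennreal (\<phi> 0) \<partial>lebesgue_on ?I) +
      (\<Sum>i. \<integral>\<^sup>+ x. ennreal (\<phi> (N i)) * indicator (A i \<inter> ?I) x \<partial>lebesgue_on ?I)"
    using A_on by (simp add: nn_integral_add nn_integral_suminf)
  also have "\<dots> = ennreal (\<phi> 0) + (\<Sum>i. ennreal (\<phi> (N i) * measure lebesgue (A i \<inter> ?I)))"
    using A_on emA assms(2)[OF N]
    by (simp add: nn_integral_cmult_indicator emeasure_restrict_space ennreal_mult)
  also have "\<dots> \<le> ennreal (\<phi> 0) + (\<Sum>i. ennreal ((1 / 2) ^ i))"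
    using A(2) by (intro add_left_mono suminf_le ennreal_leI) auto
  also have "\<dots> = ennreal (\<phi> 0) + ennreal (\<Sum>i. (1 / 2) ^ i)"
    by (subst suminf_ennreal2) (auto intro: summable_geometric)
  also have "\<dots> < \<infinity>" by (simp add: less_top)
  finally have "integrable (lebesgue_on ?I) (\<lambda>x. \<phi> \<bar>f x\<bar>)"
    using \<phi>f by (intro integrableI_bounded) auto
  moreover have "f \<in> borel_measurable (lebesgue_on ?I)"
    using f_leb by (rule measurable_restrict_space1)
  moreover have "periodic_fun_simple' f" by unfold_locales (rule f_per)
  ultimately have f_L: "f \<in> L_phi \<phi>" by (simp add: L_phi_def)

  have "\<not> convergent (\<lambda>k. riemann_mean (n_seq k) f x)" for x
  proof (rule not_convergent_if_unbounded)
    fix K :: real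
    show "\<exists>k. K \<le> riemann_mean (n_seq k) f x"
    proof (cases "x \<in> Z")
      case True
      \<comment> \<open>On \<open>Z\<close> the mean is at least \<open>(n_seq k - 1) / 2\<close>,
        and \<open>k \<le> n_seq k\<close>; this dictates the size of \<open>k\<close>.\<close>
      obtain k :: nat where k: "2 * K + 1 \<le> real k" using real_arch_simple by blast
      have "k \<le> n_seq k" using strict_mono_n_seq by (rule strict_mono_imp_increasing)
      have "n_seq k > 0" using E_set_pos range_n_seq by blast
      have "K \<le> (real (n_seq k) - 1) / 2" using k \<open>k \<le> n_seq k\<close> by simp
      also have "\<dots> \<le> riemann_mean (n_seq k) (\<lambda>x. real (coset_index x)) x"
        using \<open>n_seq k > 0\<close> by (rule riemann_mean_coset_index_ge)
      also have "\<dots> = riemann_mean (n_seq k) f x"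
        using True by (intro riemann_mean_cong) (simp add: f_def Z_step)
      finally show ?thesis by blast
    next
      case False
      obtain i0 where i0: "\<And>i. i \<ge> i0 \<Longrightarrow> x \<in> B i"
        using good[OF False] by (auto simp: eventually_sequentially)
      define i where "i = max i0 (nat \<lceil>K\<rceil>)"
      have "x \<in> B i" by (rule i0) (simp add: i_def)
      then obtain n where n: "n \<in> E_set" "real i + 1 \<le> riemann_mean n (\<lambda>x. N i * indicator (A i) x) x"
        using large by blast
      have "K \<le> real i + 1" unfolding i_def by linarith
      also note n(2)
      \<comment> \<open>All sample points avoid \<open>Z\<close>, where \<open>f = g\<close>
        dominates every single stage.\<close>
      also have "riemann_mean n (\<lambda>x. N i * indicator (A i) x) x \<le> riemann_mean n f x"
      proof (rule riemann_mean_mono)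
        fix k
        let ?y = "x + real k / real n"
        have "?y \<notin> Z" using False by (simp add: Z_step)
        then show "N i * indicator (A i) ?y \<le> f ?y"
          using h_le_g[of i ?y] by (simp add: f_def h_def indicator_def)
      qed
      finally have "K \<le> riemann_mean n f x" .
      moreover obtain k where "n = n_seq k" using n(1) range_n_seq by blast
      ultimately show ?thesis by blast
    qed
  qed
  then show ?thesis using f_L by blast
qed

end
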